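(* Let $\gamma,\gamma'\in(0,1]$ with $\gamma'\le\gamma$, let $\lambda>0$ and $\kappa\in[0,1)$. Let $S_\gamma$ be a (positive) $\gamma$-stable random variable with Laplace transform $\mathrm{E}\,e^{-uS_\gamma}=\exp\{-u^\gamma\}$. Then $$\mathrm{PDS}(\gamma',\lambda,\kappa)\stackrel{d}{=}\mathrm{PDS}\left(\gamma'/\gamma,\ \lambda^{1/\gamma}S_\gamma,\ \kappa\right).$$
   Context: For $\gamma\in(0,1]$, $\lambda>0$, $\kappa\in[0,1)$, $\mathrm{PDS}(\gamma,\lambda,\kappa)$ denotes the distribution on $\mathbb{N}_0$ (and a random variable with this distribution) with probability generating function $$\mathcal{P}(z)=\exp\left\{-\lambda\left(\frac{1-z}{1-\kappa z}\right)^{\gamma}\right\}.$$ When the parameter $\lambda$ is replaced by a positive random variable $\Lambda$, $\mathrm{PDS}(\gamma,\Lambda,\kappa)$ denotes the mixture: conditionally on $\Lambda=\ell$ the distribution is $\mathrm{PDS}(\gamma,\ell,\kappa)$. For $\gamma=1$, $S_1=1$ almost surely. *)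

theory Defs
  imports "HOL-Probability.Probability"
begin

definition pgf :: "nat pmf \<Rightarrow> real \<Rightarrow> real" where
  "pgf p z = measure_pmf.expectation p (\<lambda>n. z ^ n)"

(* A probability generating function on [0,1] determines the distribution. For \<gamma> in (0,1],
   lam > 0 (or lam = 0) and \<kappa> in [0,1) the right-hand side is the generating function of a
   compound Poisson distribution, so the description is proper there. For lam < 0 no
   distribution satisfies it and the value is an unspecified pmf not depending on lam. *)
definition PDS :: "real \<Rightarrow> real \<Rightarrow> real \<Rightarrow> nat pmf" where
  "PDS \<gamma> lam \<kappa> =
     (THE p. \<forall>z\<in>{0..1}. pgf p z = exp (- lam * ((1 - z) / (1 - \<kappa> * z)) powr \<gamma>))"

(* L is the law of the random parameter \<Lambda>; the kernel l \<mapsto> PDS \<gamma> l \<kappa> is the conditional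
   distribution given \<Lambda> = l. *)
definition PDS_mixture :: "real \<Rightarrow> real measure \<Rightarrow> real \<Rightarrow> nat measure" where
  "PDS_mixture \<gamma> L \<kappa> = L \<bind> (\<lambda>l. measure_pmf (PDS \<gamma> l \<kappa>))"

(* The Laplace transform fixes the law, including the scale. For \<gamma> = 1 it is that of the
   constant 1, so S = 1 almost surely. *)
definition positive_stable :: "'a measure \<Rightarrow> real \<Rightarrow> ('a \<Rightarrow> real) \<Rightarrow> bool" where
  "positive_stable M \<gamma> S \<longleftrightarrow>
     S \<in> borel_measurable M \<and> (AE \<omega> in M. S \<omega> > 0) \<and>
     (\<forall>u\<ge>0. (LINT \<omega>|M. exp (- u * S \<omega>)) = exp (- (u powr \<gamma>)))"

end

theory Submission
  imports Defs "HOL-Complex_Analysis.Cauchy_Integral_Formula"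
begin

text \<open>
  Write \<open>w(z) = (1 - z) / (1 - \<kappa> z)\<close>. Conditionally on the random parameter \<open>\<Lambda> = c S\<close> with
  \<open>c = \<lambda> powr (1 / \<gamma>)\<close>, the generating function of the mixture at \<open>z\<close> is
  \<open>exp (- c S w(z) powr (\<gamma>' / \<gamma>))\<close>. Its expectation is the Laplace transform of \<open>S\<close> at
  \<open>u = c w(z) powr (\<gamma>' / \<gamma>)\<close>, that is \<open>exp (- u powr \<gamma>)\<close>, and \<open>u powr \<gamma> = \<lambda> w(z) powr \<gamma>'\<close>. So the
  mixture has the generating function that characterises \<open>PDS \<gamma>' \<lambda> \<kappa>\<close>, and generating functions
  determine laws on the natural numbers (\<open>pgf_eq_imp_eq\<close>).

  For this computation the distributions \<open>PDS \<gamma> l \<kappa>\<close> must exist and depend measurably on \<open>l\<close>.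
  Both follow from an explicit construction. The function \<open>1 - w(z)\<close> is the generating function of
  a geometric law on \<open>{1, 2, ...}\<close>, and \<open>1 - (1 - x) powr \<gamma>\<close> is that of the Sibuya law, whose
  weights are the coefficients of the binomial series. Hence \<open>1 - w(z) powr \<gamma>\<close> is the generating
  function of a sum of Sibuya many independent geometric variables, and \<open>exp (- l w(z) powr \<gamma>)\<close>
  that of the compound Poisson law of rate \<open>l\<close> with such jumps (\<open>PDS_eq_compound\<close>). The parameter
  \<open>l\<close> enters only through the Poisson weights, so the family is a measurable kernel
  (\<open>measurable_PDS\<close>).
\<close>

section \<open>Probability generating functions\<close>

lemma integrable_power_pmf:
  fixes z :: real
  assumes "\<bar>z\<bar> \<le> 1"
  shows "integrable (measure_pmf p) (\<lambda>n. z ^ n)"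
  by (rule measure_pmf.integrable_const_bound[where B = 1])
     (use assms in \<open>auto simp: power_abs intro!: power_le_one\<close>)

lemma pgf_sums:
  assumes "\<bar>z\<bar> \<le> 1"
  shows "(\<lambda>n. pmf p n * z ^ n) sums pgf p z"
proof -
  have "integrable (density (count_space UNIV) (pmf p)) (\<lambda>n. z ^ n)"
    using integrable_power_pmf[OF assms, of p] by (simp add: measure_pmf_eq_density)
  then have "integrable (count_space UNIV) (\<lambda>n. pmf p n * z ^ n)"
    by (subst (asm) integrable_density) auto
  then have "(\<lambda>n. pmf p n * z ^ n) sums (LINT n|count_space UNIV. pmf p n * z ^ n)"
    by (rule sums_integral_count_space_nat)
  also have "(LINT n|count_space UNIV. pmf p n * z ^ n) = pgf p z"
    unfolding pgf_def measure_pmf_eq_density by (subst integral_density) auto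
  finally show ?thesis .
qed

lemma pgf_eqI:
  assumes "\<bar>z\<bar> \<le> 1" "(\<lambda>n. pmf p n * z ^ n) sums s"
  shows "pgf p z = s"
  using sums_unique2[OF pgf_sums[OF assms(1)] assms(2)] .

text \<open>
  The nonnegative integral turns generating functions of iterated random choices into iterated
  integrals without integrability side conditions.
\<close>
lemma ennreal_pgf:
  assumes "0 \<le> z" "z \<le> 1"
  shows "ennreal (pgf p z) = (\<integral>\<^sup>+n. ennreal (z ^ n) \<partial>measure_pmf p)"
  unfolding pgf_def
  by (rule nn_integral_eq_integral[symmetric]) (use assms in \<open>auto intro!: integrable_power_pmf\<close>)

lemma pgf_nonneg: "0 \<le> z \<Longrightarrow> 0 \<le> pgf p z"
  unfolding pgf_def by simp

lemma pgf_le_1: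
  assumes "0 \<le> z" "z \<le> 1"
  shows "pgf p z \<le> 1"
  unfolding pgf_def
  by (intro measure_pmf.integral_le_const integrable_power_pmf)
     (use assms in \<open>auto intro!: power_le_one\<close>)

text \<open>
  Equality is known only to the right of the origin, so the uniqueness theorem for power series in a
  neighbourhood of a point does not apply. It is replaced by the fact that the zeros of a nonzero
  power series are isolated: the difference of the two series vanishes on a whole interval that
  ends at the origin.
\<close>
lemma pgf_eq_imp_eq:
  assumes eq: "\<And>z. 0 \<le> z \<Longrightarrow> z \<le> 1 \<Longrightarrow> pgf p z = pgf q z"
  shows "p = q"
proof (rule ccontr)
  assume "p \<noteq> q"
  then obtain m where m: "pmf p m - pmf q m \<noteq> 0"
    by (metis eq_iff_diff_eq_0 pmf_eqI)
  have s: "(\<lambda>n. (pmf p n - pmf q n) * z ^ n) sums (pgf p z - pgf q z)" if "\<bar>z\<bar> \<le> 1" for z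
    using sums_diff[OF pgf_sums[OF that, of p] pgf_sums[OF that, of q]] by (simp add: algebra_simps)
  have "pmf p 0 = pmf q 0"
    using eq[of 0] sums_unique2[OF s[of 0] powser_sums_zero] by simp
  then have "m > 0"
    using m by (cases m) auto
  obtain r where r: "0 < r" "\<And>z. z \<in> cball 0 r - {0} \<Longrightarrow> pgf p z - pgf q z \<noteq> 0"
  proof (rule powser_0_nonzero[of 1 0 "\<lambda>n. pmf p n - pmf q n" "\<lambda>z. pgf p z - pgf q z" m])
    show "(\<lambda>n. (pmf p n - pmf q n) * (z - 0) ^ n) sums (pgf p z - pgf q z)"
      if "norm (z - 0) < 1" for z
      using s[of z] that by simp
  qed (use eq[of 0] m \<open>m > 0\<close> in simp_all)
  then show False
    using eq[of "min r 1"] by auto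
qed

section \<open>Random sums\<close>

primrec iid_sum :: "nat pmf \<Rightarrow> nat \<Rightarrow> nat pmf" where
  "iid_sum X 0 = return_pmf 0"
| "iid_sum X (Suc n) = bind_pmf X (\<lambda>a. map_pmf ((+) a) (iid_sum X n))"

definition compound_pmf :: "nat pmf \<Rightarrow> nat pmf \<Rightarrow> nat pmf" where
  "compound_pmf N X = bind_pmf N (iid_sum X)"

lemma pgf_iid_sum:
  assumes z: "0 \<le> z" "z \<le> 1"
  shows "pgf (iid_sum X n) z = pgf X z ^ n"
proof (induction n)
  case 0
  show ?case by (simp add: pgf_def)
next
  case (Suc n)
  have "ennreal (pgf (iid_sum X (Suc n)) z)
      = (\<integral>\<^sup>+a. ennreal (z ^ a) * (\<integral>\<^sup>+b. ennreal (z ^ b) \<partial>iid_sum X n) \<partial>X)"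
    using z by (simp add: ennreal_pgf power_add ennreal_mult nn_integral_cmult)
  also have "\<dots> = ennreal (pgf X z) * ennreal (pgf (iid_sum X n) z)"
    using z by (simp add: ennreal_pgf nn_integral_multc)
  also have "\<dots> = ennreal (pgf X z ^ Suc n)"
    using Suc z by (simp add: ennreal_mult pgf_nonneg)
  finally show ?case
    using z by (simp add: pgf_nonneg)
qed

text \<open>
  Given that there are \<open>n\<close> summands, the generating function is the \<open>n\<close>-th power of that of a
  single summand; averaging over \<open>n\<close> evaluates the generating function of the number of summands
  at that value.
\<close>
lemma pgf_compound:
  assumes z: "0 \<le> z" "z \<le> 1"
  shows "pgf (compound_pmf N X) z = pgf N (pgf X z)"
proof -
  have "ennreal (pgf (compound_pmf N X) z) = (\<integral>\<^sup>+n. ennreal (pgf (iid_sum X n) z) \<partial>N)"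
    using z by (simp add: ennreal_pgf compound_pmf_def)
  also have "\<dots> = ennreal (pgf N (pgf X z))"
    using z by (simp add: pgf_iid_sum ennreal_pgf[of "pgf X z" N] pgf_nonneg pgf_le_1)
  finally show ?thesis
    using z by (simp add: pgf_nonneg)
qed

section \<open>Poisson, geometric and Sibuya laws\<close>

lemma pgf_poisson:
  assumes "l > 0" "\<bar>z\<bar> \<le> 1"
  shows "pgf (poisson_pmf l) z = exp (- l * (1 - z))"
proof (rule pgf_eqI[OF assms(2)])
  have "(\<lambda>n. exp (- l) * ((l * z) ^ n /\<^sub>R fact n)) sums (exp (- l) * exp (l * z))"
    by (intro sums_mult exp_converges)
  moreover have "exp (- l) * exp (l * z) = exp (- l * (1 - z))"
    by (simp add: right_diff_distrib flip: exp_add)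
  moreover have "exp (- l) * ((l * z) ^ n /\<^sub>R fact n) = pmf (poisson_pmf l) n * z ^ n" for n
    using assms by (simp add: power_mult_distrib divide_inverse mult_ac)
  ultimately show "(\<lambda>n. pmf (poisson_pmf l) n * z ^ n) sums exp (- l * (1 - z))"
    by simp
qed

lemma pgf_Suc_geometric:
  assumes k: "0 \<le> \<kappa>" "\<kappa> < 1" and z: "0 \<le> z" "z \<le> 1"
  shows "pgf (map_pmf Suc (geometric_pmf (1 - \<kappa>))) z = 1 - (1 - z) / (1 - \<kappa> * z)"
proof -
  have kz: "\<kappa> * z < 1"
    using k z mult_left_le[of z \<kappa>] by linarith
  have mass: "pmf (geometric_pmf (1 - \<kappa>)) n * z ^ n = (1 - \<kappa>) * (\<kappa> * z) ^ n" for n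
    using k by (simp add: power_mult_distrib)
  have "pgf (map_pmf Suc (geometric_pmf (1 - \<kappa>))) z = z * pgf (geometric_pmf (1 - \<kappa>)) z"
    by (simp add: pgf_def)
  also have "pgf (geometric_pmf (1 - \<kappa>)) z = (1 - \<kappa>) * (1 / (1 - \<kappa> * z))"
  proof (rule pgf_eqI)
    show "(\<lambda>n. pmf (geometric_pmf (1 - \<kappa>)) n * z ^ n) sums ((1 - \<kappa>) * (1 / (1 - \<kappa> * z)))"
      unfolding mass using kz k z by (intro sums_mult geometric_sums) auto
  qed (use z in simp)
  also have "z * ((1 - \<kappa>) * (1 / (1 - \<kappa> * z))) = 1 - (1 - z) / (1 - \<kappa> * z)"
    using kz by (simp add: field_simps)
  finally show ?thesis .
qed

text \<open>
  The coefficients of the power series of \<open>1 - (1 - x) powr \<gamma>\<close>, which are the weights of the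
  Sibuya distribution.
\<close>
definition sibuya_weight :: "real \<Rightarrow> nat \<Rightarrow> real" where
  "sibuya_weight \<gamma> n = (if n = 0 then 1 else 0) - (\<gamma> gchoose n) * (- 1) ^ n"

text \<open>
  For \<open>n \<ge> 1\<close>, in \<open>- (-1)^n (\<gamma> gchoose n) = - (-\<gamma>) (1 - \<gamma>) (2 - \<gamma>) ... (n - 1 - \<gamma>) / n!\<close>
  the factor \<open>-\<gamma>\<close> cancels the leading sign, and the others are nonnegative because \<open>\<gamma> \<le> 1\<close>.
\<close>
lemma sibuya_weight_nonneg:
  assumes "0 \<le> \<gamma>" "\<gamma> \<le> 1"
  shows "0 \<le> sibuya_weight \<gamma> n"
proof (cases n)
  case (Suc j)
  have "sibuya_weight \<gamma> n = \<gamma> * pochhammer (1 - \<gamma>) j / fact n"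
    by (simp add: Suc sibuya_weight_def gbinomial_pochhammer pochhammer_rec flip: power_add)
  moreover have "0 \<le> pochhammer (1 - \<gamma>) j"
    using assms by (simp add: pochhammer_prod prod_nonneg)
  ultimately show ?thesis
    using assms by simp
qed (simp add: sibuya_weight_def)

lemma sibuya_weight_sums_less_1:
  assumes "\<bar>x\<bar> < 1"
  shows "(\<lambda>n. sibuya_weight \<gamma> n * x ^ n) sums (1 - (1 - x) powr \<gamma>)"
proof -
  have "(\<lambda>n. (if n = 0 then 1 else 0) * x ^ n) sums 1"
    using sums_single[of 0 "\<lambda>n. x ^ n"]
    by (simp add: if_distrib[of "\<lambda>y. y * _"] cong: if_cong)
  moreover have "(\<lambda>n. (\<gamma> gchoose n) * (- x) ^ n) sums (1 - x) powr \<gamma>"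
    using gen_binomial_real[of "- x" \<gamma>] assms by simp
  ultimately have "(\<lambda>n. (if n = 0 then 1 else 0) * x ^ n - (\<gamma> gchoose n) * (- x) ^ n)
      sums (1 - (1 - x) powr \<gamma>)"
    by (rule sums_diff)
  moreover have "(if n = 0 then 1 else 0) * x ^ n - (\<gamma> gchoose n) * (- x) ^ n
      = sibuya_weight \<gamma> n * x ^ n" for n
    by (simp add: sibuya_weight_def power_minus[of x] algebra_simps)
  ultimately show ?thesis by simp
qed

text \<open>
  The binomial series may be evaluated at the boundary point because its coefficients have one
  sign. Partial sums at \<open>x = 1\<close> are limits of partial sums at \<open>x < 1\<close>, hence at most \<open>1\<close>; conversely
  the full sum dominates \<open>1 - (1 - x) powr \<gamma>\<close> for each \<open>x < 1\<close>, and this tends to \<open>1\<close> since \<open>\<gamma> > 0\<close>.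
\<close>
lemma sibuya_weight_sums:
  assumes "0 < \<gamma>" "\<gamma> \<le> 1"
  shows "sibuya_weight \<gamma> sums 1"
proof -
  let ?a = "sibuya_weight \<gamma>"
  have nn: "0 \<le> ?a n" for n
    using assms by (intro sibuya_weight_nonneg) auto
  have left: "\<forall>\<^sub>F x :: real in at_left 1. 0 < x \<and> x < 1"
    by (rule eventually_at_leftI[of 0]) auto
  have partial: "sum ?a {..<N} \<le> 1" for N
  proof (rule tendsto_le[OF _ tendsto_const])
    have "((\<lambda>x. \<Sum>n<N. ?a n * x ^ n) \<longlongrightarrow> (\<Sum>n<N. ?a n * 1 ^ n)) (at_left 1)"
      by (intro tendsto_intros)
    then show "((\<lambda>x. \<Sum>n<N. ?a n * x ^ n) \<longlongrightarrow> sum ?a {..<N}) (at_left 1)"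
      by simp
    show "\<forall>\<^sub>F x in at_left 1. (\<Sum>n<N. ?a n * x ^ n) \<le> 1"
      using left
    proof eventually_elim
      case (elim x)
      have "(\<Sum>n<N. ?a n * x ^ n) \<le> 1 - (1 - x) powr \<gamma>"
        using sibuya_weight_sums_less_1[of x \<gamma>] nn elim
          sum_le_suminf[of "\<lambda>n. ?a n * x ^ n" "{..<N}"]
        by (auto simp: sums_iff)
      also have "\<dots> \<le> 1" by simp
      finally show ?case .
    qed
  qed simp
  have summ: "summable ?a"
  proof (rule bounded_imp_summable[OF nn])
    show "sum ?a {..n} \<le> 1" for n
      using partial[of "Suc n"] by (simp only: lessThan_Suc_atMost)
  qed
  moreover have "suminf ?a \<le> 1"
    using summ partial by (rule suminf_le_const)
  moreover have "1 \<le> suminf ?a"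
  proof (rule tendsto_le[OF _ tendsto_const])
    have "((\<lambda>x :: real. 1 - (1 - x) powr \<gamma>) \<longlongrightarrow> 1 - (1 - 1) powr \<gamma>) (at_left 1)"
      using assms by (intro tendsto_intros tendsto_powr') (auto intro!: eventually_at_leftI[of 0])
    then show "((\<lambda>x :: real. 1 - (1 - x) powr \<gamma>) \<longlongrightarrow> 1) (at_left 1)"
      by simp
    show "\<forall>\<^sub>F x in at_left 1. 1 - (1 - x) powr \<gamma> \<le> suminf ?a"
      using left
    proof eventually_elim
      case (elim x)
      have "?a n * x ^ n \<le> ?a n" for n
        using nn[of n] elim by (intro mult_left_le power_le_one) auto
      then show ?case
        using sums_le[OF _ sibuya_weight_sums_less_1[of x \<gamma>] summable_sums[OF summ]] elim by auto
    qed
  qed simp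
  ultimately show ?thesis
    by (simp add: sums_iff)
qed

definition sibuya_pmf :: "real \<Rightarrow> nat pmf" where
  "sibuya_pmf \<gamma> = embed_pmf (sibuya_weight \<gamma>)"

lemma pmf_sibuya:
  assumes "0 < \<gamma>" "\<gamma> \<le> 1"
  shows "pmf (sibuya_pmf \<gamma>) n = sibuya_weight \<gamma> n"
  unfolding sibuya_pmf_def
proof (rule pmf_embed_pmf)
  show nn: "0 \<le> sibuya_weight \<gamma> n" for n
    using assms by (intro sibuya_weight_nonneg) auto
  show "(\<integral>\<^sup>+n. ennreal (sibuya_weight \<gamma> n) \<partial>count_space UNIV) = 1"
    using suminf_ennreal_eq[OF nn sibuya_weight_sums[OF assms]]
    by (simp add: nn_integral_count_space_nat)
qed

lemma pgf_sibuya: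
  assumes "0 < \<gamma>" "\<gamma> \<le> 1" "0 \<le> z" "z \<le> 1"
  shows "pgf (sibuya_pmf \<gamma>) z = 1 - (1 - z) powr \<gamma>"
proof (rule pgf_eqI)
  show "(\<lambda>n. pmf (sibuya_pmf \<gamma>) n * z ^ n) sums (1 - (1 - z) powr \<gamma>)"
    using assms sibuya_weight_sums[of \<gamma>] sibuya_weight_sums_less_1[of z \<gamma>]
    by (cases "z = 1") (auto simp: pmf_sibuya)
qed (use assms in simp)

section \<open>The discrete stable family as a measurable kernel\<close>

text \<open>
  The law of a single jump in the compound Poisson representation.
\<close>
definition PDS_jump :: "real \<Rightarrow> real \<Rightarrow> nat pmf" where
  "PDS_jump \<gamma> \<kappa> = compound_pmf (sibuya_pmf \<gamma>) (map_pmf Suc (geometric_pmf (1 - \<kappa>)))"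

lemma pgf_PDS_jump:
  assumes "0 < \<gamma>" "\<gamma> \<le> 1" "0 \<le> \<kappa>" "\<kappa> < 1" "0 \<le> z" "z \<le> 1"
  shows "pgf (PDS_jump \<gamma> \<kappa>) z = 1 - ((1 - z) / (1 - \<kappa> * z)) powr \<gamma>"
proof -
  let ?X = "map_pmf Suc (geometric_pmf (1 - \<kappa>))"
  have "pgf (PDS_jump \<gamma> \<kappa>) z = 1 - (1 - pgf ?X z) powr \<gamma>"
    using assms by (simp add: PDS_jump_def pgf_compound pgf_sibuya pgf_nonneg pgf_le_1)
  then show ?thesis
    using assms by (simp add: pgf_Suc_geometric)
qed

lemma PDS_eqI:
  assumes "\<And>z. 0 \<le> z \<Longrightarrow> z \<le> 1 \<Longrightarrow> pgf p z = exp (- lam * ((1 - z) / (1 - \<kappa> * z)) powr \<gamma>)"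
  shows "PDS \<gamma> lam \<kappa> = p"
  unfolding PDS_def by (rule the_equality) (use assms in \<open>auto intro!: pgf_eq_imp_eq\<close>)

lemma pgf_compound_poisson_PDS_jump:
  assumes "0 < \<gamma>" "\<gamma> \<le> 1" "0 \<le> \<kappa>" "\<kappa> < 1" "lam > 0" "0 \<le> z" "z \<le> 1"
  shows "pgf (compound_pmf (poisson_pmf lam) (PDS_jump \<gamma> \<kappa>)) z
    = exp (- lam * ((1 - z) / (1 - \<kappa> * z)) powr \<gamma>)"
proof -
  let ?J = "PDS_jump \<gamma> \<kappa>"
  have "\<bar>pgf ?J z\<bar> \<le> 1"
    using assms by (simp add: pgf_nonneg pgf_le_1)
  then have "pgf (compound_pmf (poisson_pmf lam) ?J) z = exp (- lam * (1 - pgf ?J z))"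
    using assms by (simp only: pgf_compound pgf_poisson)
  then show ?thesis
    using assms by (simp add: pgf_PDS_jump)
qed

lemma PDS_eq_compound:
  assumes "0 < \<gamma>" "\<gamma> \<le> 1" "0 \<le> \<kappa>" "\<kappa> < 1" "lam > 0"
  shows "PDS \<gamma> lam \<kappa> = compound_pmf (poisson_pmf lam) (PDS_jump \<gamma> \<kappa>)"
  by (rule PDS_eqI) (rule pgf_compound_poisson_PDS_jump[OF assms])

lemma pgf_PDS:
  assumes "0 < \<gamma>" "\<gamma> \<le> 1" "0 \<le> \<kappa>" "\<kappa> < 1" "lam > 0" "0 \<le> z" "z \<le> 1"
  shows "pgf (PDS \<gamma> lam \<kappa>) z = exp (- lam * ((1 - z) / (1 - \<kappa> * z)) powr \<gamma>)"
  unfolding PDS_eq_compound[OF assms(1-5)] by (rule pgf_compound_poisson_PDS_jump[OF assms])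

text \<open>
  For a negative parameter the required value at \<open>z = 0\<close> exceeds \<open>1\<close>, so no law has the prescribed
  generating function. The defining predicate is then everywhere false, and all these descriptions
  denote the same unspecified law. A kernel must be measurable on the whole real line, so this part
  of it has to be known to be constant.
\<close>
lemma PDS_negative:
  assumes "lam < 0"
  shows "PDS \<gamma> lam \<kappa> = PDS \<gamma> (- 1) \<kappa>"
proof -
  have "\<not> (\<forall>z\<in>{0..1}. pgf p z = exp (- l * ((1 - z) / (1 - \<kappa> * z)) powr \<gamma>))" if "l < 0" for p l
    using that pgf_le_1[of 0 p] by (auto intro!: bexI[of _ 0])
  then show ?thesis
    unfolding PDS_def using assms by (simp only: neg_less_0_iff_less zero_less_one)
qed

text \<open>
  On the positive half-line the probability of a set is a series in \<open>l\<close> with Poisson weights; on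
  the negative half-line it is constant, and the origin is a single point.
\<close>
lemma measurable_PDS:
  assumes "0 < \<gamma>" "\<gamma> \<le> 1" "0 \<le> \<kappa>" "\<kappa> < 1"
  shows "(\<lambda>l. measure_pmf (PDS \<gamma> l \<kappa>)) \<in> borel \<rightarrow>\<^sub>M subprob_algebra (count_space UNIV)"
proof (rule measurable_subprob_algebra)
  fix A :: "nat set"
  let ?K = "\<lambda>n. emeasure (measure_pmf (iid_sum (PDS_jump \<gamma> \<kappa>) n)) A"
  have *: "emeasure (measure_pmf (PDS \<gamma> l \<kappa>)) A =
      (if l > 0 then (\<Sum>n. ennreal (l ^ n / fact n * exp (- l)) * ?K n)
       else if l = 0 then emeasure (measure_pmf (PDS \<gamma> 0 \<kappa>)) A
       else emeasure (measure_pmf (PDS \<gamma> (- 1) \<kappa>)) A)" for l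
    using assms PDS_negative[of l \<gamma> \<kappa>]
    by (auto simp: PDS_eq_compound compound_pmf_def emeasure_bind_pmf nn_integral_measure_pmf
        nn_integral_count_space_nat)
  show "(\<lambda>l. emeasure (measure_pmf (PDS \<gamma> l \<kappa>)) A) \<in> borel_measurable borel"
    by (subst measurable_cong[OF *]) measurable
qed (auto intro: measure_pmf.subprob_space_axioms)

section \<open>Mixing over a stable parameter\<close>

lemma prob_space_nat_eq_measure_pmf:
  fixes N :: "nat measure"
  assumes "prob_space N" "sets N = UNIV"
  obtains q where "N = measure_pmf q"
proof -
  interpret prob_space N by fact
  have "AE x in N. measure N {x} \<noteq> 0"
    using assms(2) by (subst AE_support_countable) (auto intro!: exI[of _ UNIV])
  then have "measure_pmf (Abs_pmf N) = N"
    using assms by (intro Abs_pmf_inverse) auto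
  then show ?thesis using that by metis
qed

text \<open>
  Generating functions are only defined for probability mass functions, so the mixture, a measure
  obtained from the Giry monad, is first recognised as one. Its generating function is then the
  average of the conditional ones.
\<close>
lemma PDS_mixture_eq_pmf:
  assumes "0 < \<gamma>" "\<gamma> \<le> 1" "0 \<le> \<kappa>" "\<kappa> < 1"
    and L: "prob_space L" "sets L = sets borel" "AE l in L. l > 0"
  obtains q where "PDS_mixture \<gamma> L \<kappa> = measure_pmf q"
    and "\<And>z. 0 \<le> z \<Longrightarrow> z \<le> 1 \<Longrightarrow>
      pgf q z = (LINT l|L. exp (- l * ((1 - z) / (1 - \<kappa> * z)) powr \<gamma>))"
proof -
  interpret L: prob_space L by fact
  let ?P = "\<lambda>l. measure_pmf (PDS \<gamma> l \<kappa>)"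
  have P: "?P \<in> L \<rightarrow>\<^sub>M subprob_algebra (count_space UNIV)"
    using measurable_PDS[OF assms(1-4)] by (simp add: measurable_cong_sets[OF L(2) refl])
  have "prob_space (L \<bind> ?P)"
    by (rule L.prob_space_bind[OF _ P]) (auto intro: measure_pmf.prob_space_axioms)
  moreover have "sets (L \<bind> ?P) = sets (count_space UNIV)"
    by (rule sets_bind) (auto simp: L.not_empty)
  then have "sets (L \<bind> ?P) = UNIV"
    by simp
  ultimately obtain q where q: "L \<bind> ?P = measure_pmf q"
    by (rule prob_space_nat_eq_measure_pmf)
  have pgf_q: "pgf q z = (LINT l|L. exp (- l * ((1 - z) / (1 - \<kappa> * z)) powr \<gamma>))"
    if z: "0 \<le> z" "z \<le> 1" for z
  proof -
    let ?w = "((1 - z) / (1 - \<kappa> * z)) powr \<gamma>"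
    have [measurable]: "(\<lambda>l. exp (- l * ?w)) \<in> borel_measurable L"
      unfolding measurable_cong_sets[OF L(2) refl] by measurable
    have int: "integrable L (\<lambda>l. exp (- l * ?w))"
    proof (rule L.integrable_const_bound[where B = 1])
      show "AE l in L. norm (exp (- l * ?w)) \<le> 1"
        using L(3) by eventually_elim simp
    qed measurable
    have "ennreal (pgf q z) = (\<integral>\<^sup>+l. \<integral>\<^sup>+n. ennreal (z ^ n) \<partial>?P l \<partial>L)"
      unfolding ennreal_pgf[OF z] q[symmetric] by (rule nn_integral_bind[OF _ P]) simp
    also have "\<dots> = (\<integral>\<^sup>+l. ennreal (exp (- l * ?w)) \<partial>L)"
      by (rule nn_integral_cong_AE)
        (use L(3) in eventually_elim, simp only: pgf_PDS assms(1-4) z flip: ennreal_pgf)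
    also have "\<dots> = ennreal (LINT l|L. exp (- l * ?w))"
      using int by (intro nn_integral_eq_integral) auto
    finally show ?thesis
      using z by (simp add: pgf_nonneg)
  qed
  show thesis
  proof (rule that[of q])
    show "PDS_mixture \<gamma> L \<kappa> = measure_pmf q"
      unfolding PDS_mixture_def by (rule q)
  qed (rule pgf_q)
qed

theorem theorem3p3:
  fixes \<gamma> \<gamma>' lam \<kappa> :: real and M :: "'a measure" and S :: "'a \<Rightarrow> real"
  assumes "0 < \<gamma>" and "\<gamma> \<le> 1" and "0 < \<gamma>'" and "\<gamma>' \<le> 1" and "\<gamma>' \<le> \<gamma>"
    and "lam > 0" and "0 \<le> \<kappa>" and "\<kappa> < 1"
    and "prob_space M" and "positive_stable M \<gamma> S"
  shows "measure_pmf (PDS \<gamma>' lam \<kappa>) =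
    PDS_mixture (\<gamma>' / \<gamma>) (distr M borel (\<lambda>\<omega>. lam powr (1 / \<gamma>) * S \<omega>)) \<kappa>"
proof -
  interpret prob_space M by fact
  let ?c = "lam powr (1 / \<gamma>)"
  let ?L = "distr M borel (\<lambda>\<omega>. ?c * S \<omega>)"
  have S [measurable]: "S \<in> borel_measurable M"
    and pos: "AE \<omega> in M. S \<omega> > 0"
    and laplace: "\<And>u. u \<ge> 0 \<Longrightarrow> (LINT \<omega>|M. exp (- u * S \<omega>)) = exp (- (u powr \<gamma>))"
    using assms by (auto simp: positive_stable_def)
  have ratio: "0 < \<gamma>' / \<gamma>" "\<gamma>' / \<gamma> \<le> 1"
    using assms by auto
  have L: "prob_space ?L"
    by (rule prob_space_distr) simp
  have L_pos: "AE l in ?L. l > 0"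
    using pos assms by (subst AE_distr_iff) (auto elim!: eventually_mono)
  obtain q where q: "PDS_mixture (\<gamma>' / \<gamma>) ?L \<kappa> = measure_pmf q"
    and pgf_q: "\<And>z. 0 \<le> z \<Longrightarrow> z \<le> 1 \<Longrightarrow>
      pgf q z = (LINT l|?L. exp (- l * ((1 - z) / (1 - \<kappa> * z)) powr (\<gamma>' / \<gamma>)))"
    using PDS_mixture_eq_pmf[OF ratio assms(7,8) L sets_distr L_pos] by metis
  have "PDS \<gamma>' lam \<kappa> = q"
  proof (rule PDS_eqI)
    fix z :: real assume z: "0 \<le> z" "z \<le> 1"
    let ?w = "(1 - z) / (1 - \<kappa> * z)"
    let ?u = "?c * ?w powr (\<gamma>' / \<gamma>)"
    have "pgf q z = (LINT \<omega>|M. exp (- ?u * S \<omega>))"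
      using z by (simp add: pgf_q integral_distr mult_ac)
    also have "\<dots> = exp (- (?u powr \<gamma>))"
      by (rule laplace) simp
    also have "?u powr \<gamma> = lam * ?w powr \<gamma>'"
      using assms by (simp add: powr_mult powr_powr)
    finally show "pgf q z = exp (- lam * ?w powr \<gamma>')"
      by simp
  qed
  with q show ?thesis by simp
qed

end
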